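(* For all integers $n\ge r\ge 3$, the $r$-Fibonacci polynomial $F^{[r]}_n(x_1,\dots,x_r)$ is irreducible in $\mathbb{C}[x_1,\dots,x_r]$.
   Context: For an integer $r\ge 1$, the $r$-Fibonacci polynomial $F^{[r]}_n(x_1,\dots,x_r)$ is defined by $F^{[r]}_n=0$ for $0\le n<r-1$, $F^{[r]}_{r-1}=1$, and $F^{[r]}_n=\sum_{i=1}^r x_iF^{[r]}_{n-i}$ for $n\ge r$. *)

theory Defs
  imports Complex_Main "HOL-Library.Poly_Mapping" "HOL-Algebra.Ring_Divisibility"
begin

text \<open>
  A monomial is a finitely supported exponent map \<open>nat \<Rightarrow>\<^sub>0 nat\<close>, so the type \<open>cpoly\<close> consists of
  the complex polynomials in indeterminates indexed by all natural numbers; its type class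
  multiplication is the convolution product, i.e. the usual product of polynomials.
\<close>

type_synonym cpoly = "(nat \<Rightarrow>\<^sub>0 nat) \<Rightarrow>\<^sub>0 complex"

definition var :: "nat \<Rightarrow> cpoly" where
  "var i = Poly_Mapping.single (Poly_Mapping.single i 1) 1"

text \<open>
  The ring of complex polynomials in the indeterminates \<open>var 1, \<dots>, var r\<close>.
\<close>

definition cpoly_ring :: "nat \<Rightarrow> cpoly ring" where
  "cpoly_ring r =
    \<lparr>carrier = {p. \<forall>m \<in> Poly_Mapping.keys p. Poly_Mapping.keys m \<subseteq> {1..r}},
     mult = (*), one = 1, zero = 0, add = (+)\<rparr>"

fun fib_poly :: "nat \<Rightarrow> nat \<Rightarrow> cpoly" where
  "fib_poly r n =
    (if n + 1 < r then 0
     else if n + 1 = r then 1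
     else (\<Sum>i = 1..r. var i * fib_poly r (n - i)))"

text \<open>
  The unrestricted recursion equation would make the simplifier loop.
\<close>

declare fib_poly.simps [simp del]

lemma fib_poly_below: "n < r - 1 \<Longrightarrow> fib_poly r n = 0"
  by (subst fib_poly.simps) simp

lemma fib_poly_one: "r \<ge> 1 \<Longrightarrow> fib_poly r (r - 1) = 1"
  by (subst fib_poly.simps) simp

lemma fib_poly_rec: "n \<ge> r \<Longrightarrow> fib_poly r n = (\<Sum>i = 1..r. var i * fib_poly r (n - i))"
  by (subst fib_poly.simps) simp

text \<open>
  The predicate \<open>ring_irreducible\<close> does not itself require its argument to lie in the carrier,
  hence \<open>fib_poly_in_carrier\<close> below.
\<close>

lemma cpoly_ring_add_closed:
  assumes "p \<in> carrier (cpoly_ring r)" "q \<in> carrier (cpoly_ring r)"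
  shows "p + q \<in> carrier (cpoly_ring r)"
  using assms Poly_Mapping.keys_add[of p q] by (auto simp: cpoly_ring_def)

lemma cpoly_ring_mult_closed:
  assumes "p \<in> carrier (cpoly_ring r)" "q \<in> carrier (cpoly_ring r)"
  shows "p * q \<in> carrier (cpoly_ring r)"
proof -
  have "Poly_Mapping.keys m \<subseteq> {1..r}" if m: "m \<in> Poly_Mapping.keys (p * q)" for m
  proof -
    obtain a b where "m = a + b" "a \<in> Poly_Mapping.keys p" "b \<in> Poly_Mapping.keys q"
      using m Poly_Mapping.keys_mult[of p q] by blast
    then show ?thesis
      using assms Poly_Mapping.keys_add[of a b] by (fastforce simp: cpoly_ring_def)
  qed
  then show ?thesis by (simp add: cpoly_ring_def)
qed

lemma cpoly_ring_uminus_closed: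
  "p \<in> carrier (cpoly_ring r) \<Longrightarrow> - p \<in> carrier (cpoly_ring r)"
  by (simp add: cpoly_ring_def)

lemma cpoly_ring_simps:
  "mult (cpoly_ring r) = (*)" "one (cpoly_ring r) = 1" "zero (cpoly_ring r) = 0" "add (cpoly_ring r) = (+)"
  by (simp_all add: cpoly_ring_def)

lemma cpoly_ring_zero_one_closed:
  "0 \<in> carrier (cpoly_ring r)" "1 \<in> carrier (cpoly_ring r)"
  by (simp_all add: cpoly_ring_def)

lemma cpoly_ring_domain: "domain (cpoly_ring r)"
proof (rule domainI)
  show "cring (cpoly_ring r)"
  proof (rule cringI)
    show "abelian_group (cpoly_ring r)"
    proof (rule abelian_groupI, unfold cpoly_ring_simps)
      fix x assume "x \<in> carrier (cpoly_ring r)"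
      then show "\<exists>y\<in>carrier (cpoly_ring r). y + x = 0"
        using cpoly_ring_uminus_closed by (intro bexI[of _ "- x"]) simp_all
    qed (simp_all add: cpoly_ring_add_closed cpoly_ring_zero_one_closed add.assoc add.commute)
    show "comm_monoid (cpoly_ring r)"
      by (rule comm_monoidI, unfold cpoly_ring_simps)
        (simp_all add: cpoly_ring_mult_closed cpoly_ring_zero_one_closed mult.assoc mult.commute)
  qed (simp add: cpoly_ring_simps distrib_right)
qed (simp_all add: cpoly_ring_simps)

lemma var_in_carrier: "1 \<le> i \<Longrightarrow> i \<le> r \<Longrightarrow> var i \<in> carrier (cpoly_ring r)"
  by (simp add: cpoly_ring_def var_def)

lemma fib_poly_in_carrier: "fib_poly r n \<in> carrier (cpoly_ring r)"
proof (induction n rule: less_induct)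
  case (less n)
  have sum: "(\<Sum>i\<in>A. g i) \<in> carrier (cpoly_ring r)"
    if "finite A" "\<And>i. i \<in> A \<Longrightarrow> g i \<in> carrier (cpoly_ring r)" for A :: "nat set" and g
    using that by (induction A rule: finite_induct) (auto simp: cpoly_ring_zero_one_closed cpoly_ring_add_closed)
  have "(\<Sum>i = 1..r. var i * fib_poly r (n - i)) \<in> carrier (cpoly_ring r)" if "r \<le> n"
    using that
    by (intro sum cpoly_ring_mult_closed var_in_carrier less.IH) auto
  then show ?case
    by (subst fib_poly.simps) (auto simp: cpoly_ring_zero_one_closed)
qed

end

theory Submission
  imports Defs "Jordan_Normal_Form.Char_Poly" "HOL-Computational_Algebra.Formal_Power_Series"
begin

text \<open>
  The affine cone of \<open>F = fib_poly r n\<close>, restricted to the first three indeterminates \<open>x, y, z\<close>, is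
  smooth away from the origin. With \<open>P = 1 - x t - y t\<^sup>2 - z t\<^sup>3\<close> the polynomials have generating function
  \<open>1 / P\<close>, so the three partial derivatives of \<open>F\<close> are consecutive coefficients of \<open>1 / P\<^sup>2\<close>. These
  coefficients satisfy a recurrence of order three that can be run backwards, and three consecutive
  zeros force \<open>x = y = z = 0\<close>.

  On the other hand, suppose \<open>F = A B\<close> with both factors of positive degree in \<open>x\<close>. Since \<open>F\<close> is monic in
  \<open>x\<close>, the leading coefficients of \<open>A\<close> and \<open>B\<close> are units and the resultant of \<open>A\<close> and \<open>B\<close> with respect to
  \<open>x\<close> is a polynomial in \<open>y, z\<close> whose zeros are exactly the \<open>(y, z)\<close> over which \<open>A\<close> and \<open>B\<close> have a common
  zero. It vanishes at the origin, because \<open>F\<close> becomes a power of \<open>x\<close> there, and a bivariate complex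
  polynomial has no isolated zero. So \<open>A\<close> and \<open>B\<close> have a common zero other than the origin, which is a
  singular point of \<open>F\<close>. A factor of degree zero in \<open>x\<close> equals its leading coefficient and is a unit.
\<close>

section \<open>Evaluation homomorphisms\<close>

definition monom_val :: "(nat \<Rightarrow> 'a) \<Rightarrow> (nat \<Rightarrow>\<^sub>0 nat) \<Rightarrow> 'a::comm_ring_1" where
  "monom_val f m = (\<Prod>i\<in>Poly_Mapping.keys m. f i ^ Poly_Mapping.lookup m i)"

text \<open>With the coefficient map \<open>c\<close> as a parameter, one operation covers values at
  complex points, substitutions inside \<open>cpoly\<close>, and passage to univariate and nested
  polynomials.\<close>

definition poly_ev :: "(complex \<Rightarrow> 'a) \<Rightarrow> (nat \<Rightarrow> 'a) \<Rightarrow> cpoly \<Rightarrow> 'a::comm_ring_1" where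
  "poly_ev c f p = (\<Sum>m\<in>Poly_Mapping.keys p. c (Poly_Mapping.lookup p m) * monom_val f m)"

lemma monom_val_superset:
  assumes "finite S" "Poly_Mapping.keys m \<subseteq> S"
  shows "monom_val f m = (\<Prod>i\<in>S. f i ^ Poly_Mapping.lookup m i)"
  unfolding monom_val_def using assms
  by (intro prod.mono_neutral_left) (auto simp: in_keys_iff)

lemma monom_val_0 [simp]: "monom_val f 0 = 1"
  by (simp add: monom_val_def)

lemma monom_val_add: "monom_val f (m + n) = monom_val f m * monom_val f n"
proof -
  let ?S = "Poly_Mapping.keys m \<union> Poly_Mapping.keys n"
  have "Poly_Mapping.keys (m + n) \<subseteq> ?S"
    by (rule Poly_Mapping.keys_add)
  then show ?thesis
    by (simp add: monom_val_superset[of ?S] Poly_Mapping.lookup_add power_add prod.distrib)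
qed

lemma poly_mapping_eq_sum_single:
  "p = (\<Sum>m\<in>Poly_Mapping.keys p. Poly_Mapping.single m (Poly_Mapping.lookup p m))"
proof (rule poly_mapping_eqI)
  fix k
  have "(\<Sum>m\<in>Poly_Mapping.keys p. Poly_Mapping.lookup (Poly_Mapping.single m (Poly_Mapping.lookup p m)) k)
      = (\<Sum>m\<in>Poly_Mapping.keys p. if m = k then Poly_Mapping.lookup p m else 0)"
    by (intro sum.cong) (auto simp: Poly_Mapping.lookup_single when_def)
  then show "Poly_Mapping.lookup p k =
      Poly_Mapping.lookup (\<Sum>m\<in>Poly_Mapping.keys p. Poly_Mapping.single m (Poly_Mapping.lookup p m)) k"
    by (simp add: Poly_Mapping.lookup_sum in_keys_iff)
qed

lemma poly_ev_superset:
  assumes "comm_ring_hom c" "finite S" "Poly_Mapping.keys p \<subseteq> S"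
  shows "poly_ev c f p = (\<Sum>m\<in>S. c (Poly_Mapping.lookup p m) * monom_val f m)"
proof -
  interpret comm_ring_hom c by fact
  show ?thesis
    unfolding poly_ev_def using assms(2,3)
    by (intro sum.mono_neutral_left) (auto simp: in_keys_iff)
qed

lemma poly_ev_add:
  assumes "comm_ring_hom c"
  shows "poly_ev c f (p + q) = poly_ev c f p + poly_ev c f q"
proof -
  interpret comm_ring_hom c by fact
  let ?S = "Poly_Mapping.keys p \<union> Poly_Mapping.keys q"
  have "Poly_Mapping.keys (p + q) \<subseteq> ?S"
    by (rule Poly_Mapping.keys_add)
  then show ?thesis
    by (simp add: poly_ev_superset[OF assms, of ?S] Poly_Mapping.lookup_add hom_add distrib_right
        sum.distrib)
qed

lemma poly_ev_0 [simp]: "poly_ev c f 0 = 0"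
  by (simp add: poly_ev_def)

lemma poly_ev_single:
  assumes "comm_ring_hom c"
  shows "poly_ev c f (Poly_Mapping.single m a) = c a * monom_val f m"
proof -
  interpret comm_ring_hom c by fact
  show ?thesis
    by (cases "a = 0") (simp_all add: poly_ev_def)
qed

lemma poly_ev_sum:
  assumes "comm_ring_hom c"
  shows "poly_ev c f (\<Sum>i\<in>A. g i) = (\<Sum>i\<in>A. poly_ev c f (g i))"
  by (induction A rule: infinite_finite_induct) (simp_all add: poly_ev_add[OF assms])

lemma poly_ev_mult:
  assumes "comm_ring_hom c"
  shows "poly_ev c f (p * q) = poly_ev c f p * poly_ev c f q"
proof -
  interpret comm_ring_hom c by fact
  have "p * q = (\<Sum>m\<in>Poly_Mapping.keys p. \<Sum>n\<in>Poly_Mapping.keys q.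
      Poly_Mapping.single (m + n) (Poly_Mapping.lookup p m * Poly_Mapping.lookup q n))"
    by (subst poly_mapping_eq_sum_single[of p], subst poly_mapping_eq_sum_single[of q])
      (simp add: sum_product mult_single)
  then show ?thesis
    by (simp add: poly_ev_sum[OF assms] poly_ev_single[OF assms] monom_val_add hom_mult
        poly_ev_def[of c f p] poly_ev_def[of c f q] sum_product mult_ac)
qed

lemma poly_ev_hom:
  assumes "comm_ring_hom c"
  shows "comm_ring_hom (poly_ev c f)"
proof -
  interpret comm_ring_hom c by fact
  have "poly_ev c f 1 = 1"
    using poly_ev_single[OF assms, of f 0 1] by simp
  then show ?thesis
    by unfold_locales (simp_all add: poly_ev_add[OF assms] poly_ev_mult[OF assms])
qed

lemma monom_val_var_nat:
  "(\<Prod>i\<in>S. var i ^ g i) = Poly_Mapping.single (\<Sum>i\<in>S. Poly_Mapping.single i (g i)) 1"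
proof (induction S rule: infinite_finite_induct)
  case (insert i S)
  have "var i ^ k = Poly_Mapping.single (Poly_Mapping.single i k) 1" for k
    by (induction k) (simp_all add: var_def mult_single Poly_Mapping.single_add[symmetric])
  with insert show ?case
    by (simp add: mult_single)
qed simp_all

lemma monom_val_var: "monom_val var m = Poly_Mapping.single m 1"
  unfolding monom_val_def monom_val_var_nat using poly_mapping_eq_sum_single[of m, symmetric] by simp

text \<open>Universal property: every polynomial is a sum of constants times products of
  indeterminates, so a homomorphism is determined by its effect on these.\<close>

lemma hom_eq_poly_ev:
  assumes "comm_ring_hom h"
  shows "h p = poly_ev (\<lambda>c. h (Poly_Mapping.single 0 c)) (\<lambda>i. h (var i)) p"
proof -
  interpret comm_ring_hom h by fact
  have "p = (\<Sum>m\<in>Poly_Mapping.keys p. Poly_Mapping.single 0 (Poly_Mapping.lookup p m) * monom_val var m)"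
    by (subst poly_mapping_eq_sum_single) (simp add: monom_val_var mult_single)
  then have "h p = h (\<Sum>m\<in>Poly_Mapping.keys p. Poly_Mapping.single 0 (Poly_Mapping.lookup p m) * monom_val var m)"
    by (rule arg_cong)
  then show ?thesis
    by (simp add: poly_ev_def monom_val_def hom_sum hom_mult hom_prod hom_power)
qed

section \<open>Coefficient maps and composition of homomorphisms\<close>

lemma hom_const: "comm_ring_hom (Poly_Mapping.single 0 :: complex \<Rightarrow> cpoly)"
  by unfold_locales (simp_all add: Poly_Mapping.single_add mult_single)

lemma hom_pconst: "comm_ring_hom (\<lambda>c :: 'a :: comm_ring_1. [:c:])"
  by unfold_locales auto

lemma hom_comp:
  assumes "comm_ring_hom g" "comm_ring_hom h"
  shows "comm_ring_hom (\<lambda>x. g (h x))"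
proof -
  interpret g: comm_ring_hom g by fact
  interpret h: comm_ring_hom h by fact
  show ?thesis
    by unfold_locales (simp_all add: g.hom_add h.hom_add g.hom_mult h.hom_mult)
qed

lemma hom_ident: "comm_ring_hom (\<lambda>x :: 'a :: comm_ring_1. x)"
  by unfold_locales auto

lemma hom_poly: "comm_ring_hom (\<lambda>p. poly p (x :: 'a :: comm_ring_1))"
  by unfold_locales auto

lemma hom_map_poly:
  assumes "comm_ring_hom h" shows "comm_ring_hom (map_poly h)"
proof -
  interpret comm_ring_hom h by fact
  have add: "map_poly h (p + q) = map_poly h p + map_poly h q" for p q
    by (rule map_poly_hom_add)
  have mult: "map_poly h (p * q) = map_poly h p * map_poly h q" for p q
  proof (induction p)
    case (pCons a p)
    then show ?case
      by (simp only: mult_pCons_left map_poly_hom_add map_poly_hom_smult map_poly_pCons_hom hom_zero)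
  qed simp
  show ?thesis
    by unfold_locales (simp_all only: add mult map_poly_0 map_poly_1' hom_one)
qed

lemma poly_ev_const:
  assumes "comm_ring_hom c"
  shows "poly_ev c f (Poly_Mapping.single 0 a) = c a"
  by (simp add: poly_ev_single[OF assms])

lemma poly_ev_var:
  assumes "comm_ring_hom c"
  shows "poly_ev c f (var i) = f i"
proof -
  interpret comm_ring_hom c by fact
  show ?thesis by (simp add: var_def poly_ev_single[OF assms] monom_val_def)
qed

text \<open>Reduces the comparison of iterated substitutions to a check on constants and
  indeterminates.\<close>

lemma hom_poly_ev:
  assumes "comm_ring_hom h" "comm_ring_hom c"
  shows "h (poly_ev c f p) = poly_ev (\<lambda>a. h (c a)) (\<lambda>i. h (f i)) p"
proof -
  have "comm_ring_hom (\<lambda>x. h (poly_ev c f x))"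
    by (rule hom_comp[OF assms(1) poly_ev_hom[OF assms(2)]])
  from hom_eq_poly_ev[OF this, of p] show ?thesis
    unfolding poly_ev_const[OF assms(2)] poly_ev_var[OF assms(2)] .
qed

lemma poly_ev_self: "poly_ev (Poly_Mapping.single 0) var p = p"
  using hom_eq_poly_ev[OF hom_ident, of p] by (rule sym)

lemma poly_ev_cong_carrier:
  assumes "p \<in> carrier (cpoly_ring r)" "\<And>i. i \<in> {1..r} \<Longrightarrow> f i = g i"
  shows "poly_ev c f p = poly_ev c g p"
proof -
  have "monom_val f m = monom_val g m" if "m \<in> Poly_Mapping.keys p" for m
    unfolding monom_val_def using assms that
    by (intro prod.cong) (auto simp: cpoly_ring_def subset_iff)
  then show ?thesis by (simp add: poly_ev_def)
qed

lemma poly_ev_in_carrier: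
  assumes "\<And>i. f i \<in> carrier (cpoly_ring r)"
  shows "poly_ev (Poly_Mapping.single 0) f p \<in> carrier (cpoly_ring r)"
proof -
  have pow: "x ^ k \<in> carrier (cpoly_ring r)" if "x \<in> carrier (cpoly_ring r)" for x k
    by (induction k) (simp_all add: that cpoly_ring_zero_one_closed cpoly_ring_mult_closed)
  have prd: "(\<Prod>i\<in>S. f i ^ g i) \<in> carrier (cpoly_ring r)" for g S
    by (induction S rule: infinite_finite_induct)
      (simp_all add: assms pow cpoly_ring_zero_one_closed cpoly_ring_mult_closed)
  have const: "Poly_Mapping.single 0 c \<in> carrier (cpoly_ring r)" for c
    by (simp add: cpoly_ring_def)
  have "(\<Sum>m\<in>S. Poly_Mapping.single 0 (g m) * monom_val f m) \<in> carrier (cpoly_ring r)" for g S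
    unfolding monom_val_def
    by (induction S rule: infinite_finite_induct)
      (simp_all add: prd const cpoly_ring_zero_one_closed cpoly_ring_mult_closed cpoly_ring_add_closed)
  then show ?thesis by (simp add: poly_ev_def)
qed

text \<open>An inverse among all polynomials is enough: setting the indeterminates outside the range
  to zero moves it into the carrier.\<close>

lemma cpoly_ring_Units_I:
  assumes "p \<in> carrier (cpoly_ring r)" "p * q = 1"
  shows "p \<in> Units (cpoly_ring r)"
proof -
  define s where "s = poly_ev (Poly_Mapping.single 0) (\<lambda>i. if i \<in> {1..r} then var i else 0)"
  interpret comm_ring_hom s
    unfolding s_def by (intro poly_ev_hom hom_const)
  have "s p = p"
    unfolding s_def by (subst poly_ev_cong_carrier[OF assms(1), where g = var]) (simp_all add: poly_ev_self)
  moreover have "s p * s q = 1"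
    using assms(2) by (metis hom_mult hom_one)
  moreover have "s q \<in> carrier (cpoly_ring r)"
    unfolding s_def
    by (intro poly_ev_in_carrier) (auto intro: var_in_carrier simp: cpoly_ring_zero_one_closed)
  ultimately show ?thesis
    using assms(1) by (auto simp: Units_def cpoly_ring_simps mult.commute intro!: bexI[of _ "s q"])
qed

section \<open>Common roots via the Sylvester determinant\<close>

lemma complex_poly_root:
  fixes p :: "complex poly"
  assumes "Polynomial.degree p > 0"
  obtains x where "poly p x = 0"
  using fundamental_theorem_of_algebra[of p] constant_degree[of p] assms by auto

text \<open>Euclid's lemma with coprimality expressed by roots. A root of \<open>a\<close> is not a
  root of \<open>b\<close>, hence is one of \<open>w\<close>; its linear factor cancels from both,
  and induction on the degree of \<open>a\<close> finishes.\<close>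

lemma dvd_of_dvd_mult_no_common_root:
  fixes a b w :: "complex poly"
  assumes "a dvd w * b" "\<And>x. poly a x = 0 \<Longrightarrow> poly b x \<noteq> 0" "b \<noteq> 0"
  shows "a dvd w"
  using assms
proof (induction "Polynomial.degree a" arbitrary: a w)
  case 0
  show ?case
  proof (cases "a = 0")
    case False
    then have "is_unit a"
      using 0 by (simp add: is_unit_iff_degree)
    then show ?thesis
      by (rule unit_imp_dvd)
  qed (use 0 in auto)
next
  case (Suc n)
  then obtain x where x: "poly a x = 0"
    using complex_poly_root[of a] by force
  then obtain a' where a': "a = [:-x, 1:] * a'"
    by (auto simp: poly_eq_0_iff_dvd elim: dvdE)
  obtain k where "w * b = a * k"
    using Suc.prems(1) by (elim dvdE)
  then have "poly (w * b) x = poly (a * k) x"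
    by (rule arg_cong)
  with Suc.prems(2)[OF x] x have "poly w x = 0"
    by simp
  then obtain w' where w': "w = [:-x, 1:] * w'"
    by (auto simp: poly_eq_0_iff_dvd elim: dvdE)
  have "a' \<noteq> 0"
    using Suc.hyps(2) a' by auto
  then have "Polynomial.degree a = Suc (Polynomial.degree a')"
    by (simp only: a') (subst degree_mult_eq; simp)
  then have "n = Polynomial.degree a'"
    using Suc.hyps(2) by simp
  moreover have "a' dvd w' * b"
  proof -
    have "[:-x, 1:] * a' dvd [:-x, 1:] * (w' * b)"
      using Suc.prems(1) by (simp only: a' w' mult.assoc)
    then show ?thesis
      by (subst (asm) dvd_mult_cancel_left) simp
  qed
  moreover have "poly b t \<noteq> 0" if "poly a' t = 0" for t
    using Suc.prems(2)[of t] that by (simp add: a')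
  ultimately have "a' dvd w'"
    using Suc.hyps(1) Suc.prems(3) by blast
  then show ?case
    unfolding a' w' by (rule mult_dvd_mono[OF dvd_refl])
qed

text \<open>The degree bounds are parameters, so that the matrix commutes with homomorphisms that lower the
  degree of \<open>a\<close> or \<open>b\<close>.\<close>

definition sylvester :: "nat \<Rightarrow> nat \<Rightarrow> 'a poly \<Rightarrow> 'a poly \<Rightarrow> 'a::comm_ring_1 mat" where
  "sylvester p q a b = mat (p + q) (p + q) (\<lambda>(i, j). Polynomial.coeff
     (if j < q then Polynomial.monom 1 j * a else Polynomial.monom 1 (j - q) * b) i)"

lemma sylvester_carrier [simp]: "sylvester p q a b \<in> carrier_mat (p + q) (p + q)"
  by (simp add: sylvester_def)

text \<open>Specialisation of the resultant: the matrix entries are coefficients or zeros, and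
  determinants commute with homomorphisms.\<close>

lemma det_sylvester_hom:
  assumes "comm_ring_hom h"
  shows "det (sylvester p q (map_poly h a) (map_poly h b)) = h (det (sylvester p q a b))"
proof -
  interpret comm_ring_hom h by fact
  have "sylvester p q (map_poly h a) (map_poly h b) = map_mat h (sylvester p q a b)"
    by (rule eq_matI) (auto simp: sylvester_def coeff_monom_mult)
  then show ?thesis by simp
qed

lemma poly_eq_sum_less:
  fixes P :: "'a::comm_ring_1 poly"
  assumes "Polynomial.degree P < N"
  shows "poly P x = (\<Sum>i<N. Polynomial.coeff P i * x ^ i)"
  unfolding poly_altdef using assms
  by (intro sum.mono_neutral_left) (auto simp: coeff_eq_0)

text \<open>Each column holds the coefficients of a multiple of \<open>a\<close> or
  \<open>b\<close>, so pairing it with the vector of powers of \<open>x\<close> gives the value at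
  \<open>x\<close>, which is 0. That vector is nonzero because its entry at index 0 is 1, even for
  \<open>x = 0\<close>.\<close>

lemma det_sylvester_eq_0_of_common_root:
  fixes a b :: "complex poly"
  assumes "Polynomial.degree a = p" "Polynomial.degree b = q" "p > 0"
    and "poly a x = 0" "poly b x = 0"
  shows "det (sylvester p q a b) = 0"
proof -
  let ?M = "sylvester p q a b" and ?v = "vec (p + q) (\<lambda>i. x ^ i)"
  have "transpose_mat ?M *\<^sub>v ?v = 0\<^sub>v (p + q)"
  proof (rule eq_vecI)
    fix j assume "j < dim_vec (0\<^sub>v (p + q) :: complex vec)"
    then have j: "j < p + q" by simp
    let ?C = "if j < q then Polynomial.monom 1 j * a else Polynomial.monom 1 (j - q) * b"
    have degC: "Polynomial.degree (Polynomial.monom 1 k * c) \<le> k + Polynomial.degree c" for k and c :: "complex poly"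
      using degree_mult_le[of "Polynomial.monom 1 k" c] degree_monom_le[of "1::complex" k] by simp
    have deg: "Polynomial.degree ?C < p + q"
    proof (cases "j < q")
      case True
      then show ?thesis using degC[of j a] assms(1) by simp
    next
      case False
      then show ?thesis using degC[of "j - q" b] assms(2) j by simp
    qed
    have "poly ?C x = 0"
      using assms(4,5) by simp
    then have "(\<Sum>i<p + q. Polynomial.coeff ?C i * x ^ i) = 0"
      using poly_eq_sum_less[OF deg, of x] by simp
    then show "vec_index (transpose_mat ?M *\<^sub>v ?v) j = vec_index (0\<^sub>v (p + q)) j"
      using j by (simp add: sylvester_def scalar_prod_def lessThan_atLeast0)
  qed (simp add: sylvester_def)
  moreover have "vec_index ?v 0 = 1"
    using \<open>p > 0\<close> by simp
  then have "?v \<noteq> 0\<^sub>v (p + q)"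
    using \<open>p > 0\<close> by (metis add_gr_0 index_zero_vec(1) zero_neq_one)
  ultimately have "det (transpose_mat ?M) = 0"
    by (subst det_0_iff_vec_prod_zero[of _ "p + q"]) (auto intro!: exI[of _ ?v])
  then show ?thesis
    by (simp add: det_transpose[of _ "p + q"])
qed

text \<open>A kernel vector encodes a relation \<open>u * a + w * b = 0\<close> with
  \<open>u\<close> of degree below \<open>q\<close> and \<open>w\<close> of degree below
  \<open>p\<close>. Without a common root \<open>a\<close> would divide \<open>w\<close>, which
  forces \<open>w = 0\<close>, then \<open>u = 0\<close>.\<close>

lemma common_root_of_det_sylvester_eq_0:
  fixes a b :: "complex poly"
  assumes "Polynomial.degree a = p" "Polynomial.degree b = q" "a \<noteq> 0" "b \<noteq> 0"
    and "det (sylvester p q a b) = 0"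
  shows "\<exists>x. poly a x = 0 \<and> poly b x = 0"
proof (rule ccontr)
  assume no: "\<not> ?thesis"
  obtain v where v: "v \<in> carrier_vec (p + q)" "v \<noteq> 0\<^sub>v (p + q)"
      and Mv: "sylvester p q a b *\<^sub>v v = 0\<^sub>v (p + q)"
    using assms(5) det_0_iff_vec_prod_zero[OF sylvester_carrier, of p q a b] by auto
  define C where "C j = (if j < q then Polynomial.monom 1 j * a else Polynomial.monom 1 (j - q) * b)" for j
  \<comment> \<open>The first \<open>q\<close> entries of the kernel vector belong to shifts of
    \<open>a\<close>, the last \<open>p\<close> to shifts of \<open>b\<close>.\<close>
  define u where "u = (\<Sum>j<q. Polynomial.monom (vec_index v j) j)"
  define w where "w = (\<Sum>j<p. Polynomial.monom (vec_index v (q + j)) j)"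
  have coeff_u: "Polynomial.coeff u j = (if j < q then vec_index v j else 0)" for j
    by (simp add: u_def coeff_sum)
  have coeff_w: "Polynomial.coeff w j = (if j < p then vec_index v (q + j) else 0)" for j
    by (simp add: w_def coeff_sum)
  have split: "(\<Sum>j<q + n. g j) = (\<Sum>j<q. g j) + (\<Sum>j<n. g (q + j))" for g :: "nat \<Rightarrow> complex poly" and n
    by (induction n) (simp_all add: add.assoc)
  have "(\<Sum>j<q + p. smult (vec_index v j) (C j)) = u * a + w * b"
    by (simp add: split C_def u_def w_def sum_distrib_right smult_monom flip: mult_smult_left)
  then have uw: "u * a + w * b = (\<Sum>j<p + q. smult (vec_index v j) (C j))"
    by (simp add: add.commute)
  have "u * a + w * b = 0"
  proof (rule poly_eqI)
    fix i
    show "Polynomial.coeff (u * a + w * b) i = Polynomial.coeff 0 i"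
    proof (cases "i < p + q")
      case True
      have "vec_index (sylvester p q a b *\<^sub>v v) i = 0"
        using True by (simp add: Mv)
      then show ?thesis
        using True v(1) unfolding uw
        by (simp add: sylvester_def scalar_prod_def coeff_sum C_def lessThan_atLeast0 mult.commute)
    next
      case False
      \<comment> \<open>Both products have degree below \<open>p + q\<close>, so the matrix equation
        has captured all their coefficients.\<close>
      have "Polynomial.coeff (u * a) i = 0"
        unfolding coeff_mult using False assms(1)
        by (intro sum.neutral ballI) (auto simp: coeff_u coeff_eq_0)
      moreover have "Polynomial.coeff (w * b) i = 0"
        unfolding coeff_mult using False assms(2)
        by (intro sum.neutral ballI) (auto simp: coeff_w coeff_eq_0)
      ultimately show ?thesis by simp
    qed
  qed
  then have eq: "w * b = - u * a"
    by (simp add: eq_neg_iff_add_eq_0 add.commute)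
  then have "a dvd w * b"
    by (metis dvd_triv_right)
  then have "a dvd w"
    using no assms(4) by (metis dvd_of_dvd_mult_no_common_root)
  have "w = 0"
  proof (rule ccontr)
    assume "w \<noteq> 0"
    then have "p \<le> Polynomial.degree w"
      using \<open>a dvd w\<close> assms(1) dvd_imp_degree_le by blast
    moreover have "Polynomial.coeff w (Polynomial.degree w) \<noteq> 0"
      using \<open>w \<noteq> 0\<close> by simp
    ultimately show False by (simp add: coeff_w)
  qed
  moreover from this eq assms(3) have "u = 0" by simp
  ultimately have "vec_index v j = 0" if "j < p + q" for j
    using coeff_u[of j] coeff_w[of "j - q"] that  by (cases "j < q") (auto split: if_splits)
  then have "v = 0\<^sub>v (p + q)"
    using v(1) by (intro eq_vecI) auto
  with v(2) show False by simp
qed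

text \<open>The outer variable is \<open>z\<close>, the inner one \<open>y\<close>. If no zero but
  the origin existed, then for each \<open>y \<noteq> 0\<close> the slice in \<open>z\<close> would
  have no root and so be constant. The higher coefficients in \<open>z\<close> would then vanish at
  infinitely many \<open>y\<close>, hence identically.\<close>

lemma bivariate_zero_not_isolated:
  fixes R :: "complex poly poly"
  assumes "poly (poly R [:0:]) 0 = 0"
  shows "\<exists>y z. (y \<noteq> 0 \<or> z \<noteq> 0) \<and> poly (poly R [:z:]) y = 0"
proof (rule ccontr)
  assume no: "\<not> ?thesis"
  have slice: "poly (map_poly (\<lambda>p. poly p y) R) z = poly (poly R [:z:]) y" for y z
    by (induction R) (simp_all add: map_poly_pCons)
  have "Polynomial.coeff R k = 0" if "k > 0" for k
  proof -
    have "poly (Polynomial.coeff R k) y = 0" if "y \<noteq> 0" for y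
    proof -
      have "Polynomial.degree (map_poly (\<lambda>p. poly p y) R) = 0"
        using complex_poly_root[of "map_poly (\<lambda>p. poly p y) R"] no that
        by (metis gr0I slice)
      then have "Polynomial.coeff (map_poly (\<lambda>p. poly p y) R) k = 0"
        using \<open>k > 0\<close> by (intro coeff_eq_0) simp
      then show ?thesis by (simp add: coeff_map_poly)
    qed
    then have "- {0} \<subseteq> {y. poly (Polynomial.coeff R k) y = 0}"
      by auto
    moreover have "infinite (- {0 :: complex})"
      by (simp add: infinite_UNIV_char_0)
    ultimately show ?thesis
      using poly_roots_finite finite_subset by blast
  qed
  then have "R = [:Polynomial.coeff R 0:]"
    by (intro poly_eqI) (simp add: coeff_pCons split: nat.split)
  then obtain c where "R = [:c:]" by blast
  \<comment> \<open>Independence of \<open>z\<close> carries the zero at the origin over to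
    \<open>y = 0\<close>, \<open>z = 1\<close>.\<close>
  with assms have "poly (poly R [:1:]) 0 = 0" by simp
  with no show False by (metis one_neq_zero)
qed

section \<open>The recurrence of the gradient\<close>

text \<open>If \<open>z \<noteq> 0\<close>, the recurrence runs backwards and carries three
  consecutive zeros down to \<open>e 2 = 1\<close>. With \<open>z = 0\<close> the same descent works
  for two zeros if \<open>y \<noteq> 0\<close>, and then for one if \<open>x \<noteq> 0\<close>. The
  integer factors are nonzero in characteristic 0.\<close>

lemma three_zeros_of_recurrence:
  fixes e :: "nat \<Rightarrow> complex"
  assumes e: "e 0 = 0" "e 1 = 0" "e 2 = 1"
    and rec: "\<And>k. of_nat (k + 1) * e (k + 3) = of_nat (k + 2) * x * e (k + 2)
        + of_nat (k + 3) * y * e (k + 1) + of_nat (k + 4) * z * e k"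
    and zeros: "e k = 0" "e (k + 1) = 0" "e (k + 2) = 0"
  shows "x = 0 \<and> y = 0 \<and> z = 0"
proof -
  have nz: "of_nat (k + Suc j) \<noteq> (0 :: complex)" for k j
    unfolding of_nat_eq_0_iff by simp
  have z0: "z = 0"
  proof (rule ccontr)
    assume "z \<noteq> 0"
    have "\<not> (e k = 0 \<and> e (k + 1) = 0 \<and> e (k + 2) = 0)" for k
    proof (induction k)
      case 0
      then show ?case using e by (simp add: numeral_2_eq_2)
    next
      case (Suc k)
      then show ?case
        using rec[of k] \<open>z \<noteq> 0\<close> nz[of k 3] by (auto simp: numeral_eq_Suc)
    qed
    with zeros show False by blast
  qed
  have y0: "y = 0"
  proof (rule ccontr)
    assume "y \<noteq> 0"
    have "\<not> (e (k + 1) = 0 \<and> e (k + 2) = 0)" for k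
    proof (induction k)
      case 0
      then show ?case using e by (simp add: numeral_2_eq_2)
    next
      case (Suc k)
      then show ?case
        using rec[of k] \<open>y \<noteq> 0\<close> z0 nz[of k 2] by (auto simp: numeral_eq_Suc)
    qed
    with zeros show False by blast
  qed
  have "x = 0"
  proof (rule ccontr)
    assume "x \<noteq> 0"
    have "e (k + 2) \<noteq> 0" for k
    proof (induction k)
      case 0
      then show ?case using e by (simp add: numeral_2_eq_2)
    next
      case (Suc k)
      then show ?case
        using rec[of k] \<open>x \<noteq> 0\<close> z0 y0 nz[of k 1] nz[of k 0] by (auto simp: numeral_eq_Suc)
    qed
    with zeros show False by blast
  qed
  with y0 z0 show ?thesis by blast
qed

section \<open>Power series and the inverse square of the denominator\<close>

definition char_fps :: "complex \<Rightarrow> complex \<Rightarrow> complex \<Rightarrow> complex fps" where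
  "char_fps x y z = 1 - fps_const x * fps_X - fps_const y * fps_X ^ 2 - fps_const z * fps_X ^ 3"

text \<open>Multiplication by the denominator applies the recurrence to the coefficients; the guards
  treat coefficients of negative index as 0 despite truncated subtraction.\<close>

lemma char_fps_mult_nth:
  "fps_nth (f * char_fps x y z) n = fps_nth f n - (if n < 1 then 0 else x * fps_nth f (n - 1))
    - (if n < 2 then 0 else y * fps_nth f (n - 2)) - (if n < 3 then 0 else z * fps_nth f (n - 3))"
proof -
  have "f * char_fps x y z = f - fps_const x * (fps_X ^ 1 * f) - fps_const y * (fps_X ^ 2 * f)
      - fps_const z * (fps_X ^ 3 * f)"
    by (simp add: char_fps_def algebra_simps)
  then show ?thesis
    by (simp only: fps_sub_nth fps_mult_left_const_nth fps_X_power_mult_nth) simp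
qed

lemma char_fps_nonzero: "char_fps x y z \<noteq> 0"
proof
  assume "char_fps x y z = 0"
  then have "fps_nth (1 * char_fps x y z) 0 = 0" by simp
  then show False by (subst (asm) char_fps_mult_nth) simp
qed

text \<open>Multiplying out \<open>P\<^sup>2\<close> gives a recurrence of order six; the differential equation
  \<open>(E / t\<^sup>2)' P = - 2 P' (E / t\<^sup>2)\<close> gives one of order three.\<close>

lemma inverse_square_recurrence:
  assumes E: "E * char_fps x y z ^ 2 = fps_X ^ 2"
  shows "fps_nth E 0 = 0" "fps_nth E 1 = 0" "fps_nth E 2 = 1"
    and "of_nat (k + 1) * fps_nth E (k + 3) = of_nat (k + 2) * x * fps_nth E (k + 2)
        + of_nat (k + 3) * y * fps_nth E (k + 1) + of_nat (k + 4) * z * fps_nth E k"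
proof -
  let ?P = "char_fps x y z"
  let ?Q = "fps_const x * fps_X + 2 * fps_const y * fps_X ^ 2 + 3 * fps_const z * fps_X ^ 3"
  have nth: "fps_nth ((E * ?P) * ?P) n = (if n = 2 then 1 else 0)" for n
  proof -
    have "E * ?P * ?P = fps_X ^ 2"
      using E by (simp only: power2_eq_square mult.assoc)
    then show ?thesis by (simp only: fps_X_power_nth)
  qed
  have 0: "fps_nth E 0 = 0"
    using nth[of 0] unfolding char_fps_mult_nth by simp
  have 1: "fps_nth E 1 = 0"
    using nth[of 1] 0 unfolding char_fps_mult_nth by simp
  have 2: "fps_nth E 2 = 1"
    using nth[of 2] 0 1 unfolding char_fps_mult_nth by simp
  show "fps_nth E 0 = 0" "fps_nth E 1 = 0" "fps_nth E 2 = 1" by fact+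
  have dX: "fps_deriv (fps_X ^ 2) = 2 * (fps_X :: complex fps)"
    "fps_deriv (fps_X ^ 3) = 3 * (fps_X :: complex fps) ^ 2"
    by (simp_all add: fps_deriv_power flip: numeral_fps_const)
  have P': "fps_deriv ?P = - fps_const x - fps_const y * (2 * fps_X) - fps_const z * (3 * fps_X ^ 2)"
    unfolding char_fps_def fps_deriv_sub fps_deriv_mult_const_left dX by simp
  have dP: "fps_X * fps_deriv ?P = - ?Q"
    unfolding P' by (simp add: algebra_simps power2_eq_square power3_eq_cube del: fps_const_neg)
  have "fps_deriv E * ?P ^ 2 + E * (2 * ?P * fps_deriv ?P) = 2 * fps_X"
    using arg_cong[OF E, of fps_deriv] by (simp add: fps_deriv_power power2_eq_square algebra_simps)
  \<comment> \<open>The extra factor \<open>fps_X\<close> turns the right-hand side back into a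
    multiple of \<open>E * ?P ^ 2\<close>, so that one factor \<open>?P\<close> cancels.\<close>
  then have "fps_X * (fps_deriv E * ?P ^ 2 + E * (2 * ?P * fps_deriv ?P)) = 2 * (E * ?P ^ 2)"
    unfolding E by (simp add: power2_eq_square)
  then have "?P * (fps_X * fps_deriv E * ?P + 2 * E * (fps_X * fps_deriv ?P)) = ?P * (2 * E * ?P)"
    by (simp only: power2_eq_square) (simp only: algebra_simps)
  then have "fps_X * fps_deriv E * ?P + 2 * E * (fps_X * fps_deriv ?P) = 2 * E * ?P"
    using char_fps_nonzero by simp
  then have de: "(fps_X * fps_deriv E - 2 * E) * ?P = 2 * (E * ?Q)"
    unfolding dP by (simp add: algebra_simps)
  \<comment> \<open>Euler operator: the shift by 2 accounts for the factor \<open>fps_X ^ 2\<close>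
    in \<open>E\<close>.\<close>
  have 3: "fps_nth (fps_X * fps_deriv E - 2 * E) n = (of_nat n - 2) * fps_nth E n" for n
    by (cases n) (simp_all add: algebra_simps numeral_fps_const)
  have "E * ?Q = fps_const x * (fps_X ^ 1 * E) + fps_const (2 * y) * (fps_X ^ 2 * E)
      + fps_const (3 * z) * (fps_X ^ 3 * E)"
    by (simp add: algebra_simps numeral_fps_const)
  then have 4: "fps_nth (2 * (E * ?Q)) (k + 3) = 2 * (x * fps_nth E (k + 2)
      + 2 * y * fps_nth E (k + 1) + 3 * z * fps_nth E k)"
    by (simp only: numeral_fps_const fps_add_nth fps_mult_left_const_nth fps_X_power_mult_nth) simp
  from arg_cong[OF de, of "\<lambda>f. fps_nth f (k + 3)"]
  have "(of_nat (k + 3) - 2) * fps_nth E (k + 3) - x * ((of_nat (k + 2) - 2) * fps_nth E (k + 2))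
      - y * ((of_nat (k + 1) - 2) * fps_nth E (k + 1)) - z * ((of_nat k - 2) * fps_nth E k)
      = 2 * (x * fps_nth E (k + 2) + 2 * y * fps_nth E (k + 1) + 3 * z * fps_nth E k)"
    unfolding char_fps_mult_nth 3 4 by simp
  then show "of_nat (k + 1) * fps_nth E (k + 3) = of_nat (k + 2) * x * fps_nth E (k + 2)
        + of_nat (k + 3) * y * fps_nth E (k + 1) + of_nat (k + 4) * z * fps_nth E k"
    by (simp add: algebra_simps)
qed

text \<open>Here \<open>u k\<close> and \<open>d i k\<close> stand for the value and the \<open>i\<close>-th partial derivative of \<open>fib_poly r k\<close> at
  the point \<open>(x, y, z, 0, \<dots>, 0)\<close>.\<close>

lemma no_common_zero_of_derivatives:
  fixes u :: "nat \<Rightarrow> complex" and d :: "nat \<Rightarrow> nat \<Rightarrow> complex"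
  assumes "r \<ge> 3" "n \<ge> r"
    and u: "\<And>k. k < r - 1 \<Longrightarrow> u k = 0" "u (r - 1) = 1"
      "\<And>k. k \<ge> r \<Longrightarrow> u k = x * u (k - 1) + y * u (k - 2) + z * u (k - 3)"
    and d: "\<And>i k. k < r \<Longrightarrow> d i k = 0"
      "\<And>i k. i \<in> {1..3} \<Longrightarrow> k \<ge> r \<Longrightarrow>
        d i k = x * d i (k - 1) + y * d i (k - 2) + z * d i (k - 3) + u (k - i)"
    and zero: "\<And>i. i \<in> {1..3} \<Longrightarrow> d i n = 0"
  shows "x = 0 \<and> y = 0 \<and> z = 0"
proof -
  let ?P = "char_fps x y z"
  \<comment> \<open>The factor \<open>fps_X ^ 2\<close> keeps the three indices
    \<open>n - r\<close>, \<open>n - r + 1\<close>, \<open>n - r + 2\<close> used below nonnegative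
    even for \<open>n = r\<close>, and yields the initial values 0, 0, 1.\<close>
  define E where "E = fps_X ^ 2 * inverse (?P ^ 2)"
  have P0: "fps_nth ?P 0 = 1"
    using char_fps_mult_nth[of 1 x y z 0] by simp
  have inv: "inverse (?P ^ 2) * ?P ^ 2 = 1"
    by (rule inverse_mult_eq_1) (simp add: P0 fps_power_zeroth)
  then have E: "E * ?P ^ 2 = fps_X ^ 2"
    by (simp add: E_def mult.assoc)
  have U: "Abs_fps u * ?P = fps_X ^ (r - 1)"
  proof (rule fps_ext)
    fix k
    consider "k < r - 1" | "k = r - 1" | "k \<ge> r" by linarith
    then show "fps_nth (Abs_fps u * ?P) k = fps_nth (fps_X ^ (r - 1)) k"
      unfolding char_fps_mult_nth using \<open>r \<ge> 3\<close> u
      by cases (auto simp: fps_X_power_nth)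
  qed
  \<comment> \<open>This is the derivative of \<open>fps_X ^ (r - 1) / P\<close> in the
    \<open>i\<close>-th indeterminate, with one factor \<open>P\<close> cleared.\<close>
  have D: "Abs_fps (d i) * ?P = fps_X ^ i * Abs_fps u" if i: "i \<in> {1..3}" for i
  proof (rule fps_ext)
    fix k
    consider "k < r" | "k \<ge> r" by linarith
    then show "fps_nth (Abs_fps (d i) * ?P) k = fps_nth (fps_X ^ i * Abs_fps u) k"
      unfolding char_fps_mult_nth fps_X_power_mult_nth using \<open>r \<ge> 3\<close> u(1) d i
      by cases auto
  qed
  have zE: "fps_nth E (n - (r - 1) + 2 - i) = 0" if i: "i \<in> {1..3}" for i
  proof -
    have "fps_X ^ 2 * Abs_fps (d i) * ?P ^ 2 = fps_X ^ 2 * ((Abs_fps (d i) * ?P) * ?P)"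
      by (simp only: power2_eq_square mult.assoc)
    also have "\<dots> = fps_X ^ 2 * (fps_X ^ i * (Abs_fps u * ?P))"
      by (simp only: D[OF i] mult.assoc)
    also have "\<dots> = fps_X ^ (i + (r - 1)) * (E * ?P ^ 2)"
      by (simp only: U E power_add mult_ac)
    also have "\<dots> = fps_X ^ (i + (r - 1)) * E * ?P ^ 2"
      by (simp only: mult.assoc)
    finally have "fps_X ^ 2 * Abs_fps (d i) = fps_X ^ (i + (r - 1)) * E"
      using char_fps_nonzero by simp
    \<comment> \<open>Index \<open>n + 2\<close> picks out \<open>d i n\<close> on the left, because
      of the factor \<open>fps_X ^ 2\<close>.\<close>
    from arg_cong[OF this, of "\<lambda>f. fps_nth f (n + 2)"]
    have "fps_nth (fps_X ^ (i + (r - 1)) * E) (n + 2) = 0"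
      using zero[OF i] by (simp only: fps_X_power_mult_nth) simp
    moreover have "\<not> n + 2 < i + (r - 1)" "n + 2 - (i + (r - 1)) = n - (r - 1) + 2 - i"
      using i \<open>n \<ge> r\<close> \<open>r \<ge> 3\<close> by auto
    ultimately show ?thesis
      by (simp only: fps_X_power_mult_nth if_False)
  qed
  show ?thesis
  proof (rule three_zeros_of_recurrence[of "fps_nth E"])
    show "fps_nth E (n - r) = 0"  "fps_nth E (n - r + 1) = 0"  "fps_nth E (n - r + 2) = 0"
      using zE[of 3] zE[of 2] zE[of 1] \<open>r \<ge> 3\<close> \<open>n \<ge> r\<close>
      by (simp_all add: numeral_eq_Suc Suc_diff_le Suc_diff_Suc)
  qed (rule inverse_square_recurrence[OF E])+
qed

section \<open>Irreducibility\<close>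

lemma hom_fib_poly_rec:
  assumes "comm_ring_hom h" "n \<ge> r"
  shows "h (fib_poly r n) = (\<Sum>i = 1..r. h (var i) * h (fib_poly r (n - i)))"
proof -
  interpret comm_ring_hom h by fact
  show ?thesis
    by (subst fib_poly_rec[OF assms(2)]) (simp only: hom_sum hom_mult)
qed

section \<open>Polynomials in the first indeterminate\<close>

definition as_poly_var1 :: "cpoly \<Rightarrow> cpoly poly" where
  "as_poly_var1 = poly_ev (\<lambda>c. [:Poly_Mapping.single 0 c:]) (\<lambda>i. if i = 1 then [:0, 1:] else [:var i:])"

lemma const_cpoly_poly_hom: "comm_ring_hom (\<lambda>c. [:Poly_Mapping.single 0 c:] :: cpoly poly)"
  by (rule hom_comp[OF hom_pconst hom_const])

lemma as_poly_var1_hom: "comm_ring_hom as_poly_var1"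
  unfolding as_poly_var1_def by (rule poly_ev_hom[OF const_cpoly_poly_hom])

lemma as_poly_var1_var: "as_poly_var1 (var i) = (if i = 1 then [:0, 1:] else [:var i:])"
  by (simp only: as_poly_var1_def poly_ev_var[OF const_cpoly_poly_hom])

text \<open>Substituting \<open>var 1\<close> back inverts the conversion; in particular a
  polynomial of degree 0 in \<open>var 1\<close> equals its leading coefficient.\<close>

lemma poly_as_poly_var1: "poly (as_poly_var1 p) (var 1) = p"
proof -
  have "(\<lambda>i. poly (if i = 1 then [:0, 1:] else [:var i:]) (var 1)) = var"
    by (rule ext) simp
  then show ?thesis
    unfolding as_poly_var1_def hom_poly_ev[OF hom_poly const_cpoly_poly_hom]
    by (simp add: poly_ev_self)
qed

text \<open>Only the summand with \<open>var 1\<close> can reach the top degree. Truncated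
  subtraction lets the bound include the zero polynomials of small index that the recursion
  reaches.\<close>

lemma as_poly_var1_fib_poly:
  assumes "r \<ge> 1"
  shows "Polynomial.degree (as_poly_var1 (fib_poly r n)) \<le> n + 1 - r \<and>
    (n + 1 \<ge> r \<longrightarrow> Polynomial.coeff (as_poly_var1 (fib_poly r n)) (n + 1 - r) = 1)"
proof (induction n rule: less_induct)
  case (less n)
  interpret comm_ring_hom as_poly_var1 by (rule as_poly_var1_hom)
  let ?f = "\<lambda>k. as_poly_var1 (fib_poly r k)"
  consider "n + 1 < r" | "n + 1 = r" | "n \<ge> r" by linarith
  then show ?case
  proof cases
    case 1
    then show ?thesis by (simp add: fib_poly_below)
  next
    case 2
    then have "n = r - 1" by simp
    then show ?thesis using assms by (simp add: fib_poly_one del: One_nat_def)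
  next
    case 3
    define m where "m = n - r"
    have m: "n + 1 - r = Suc m" using 3 by (simp add: m_def)
    have "{1..r} = insert 1 {2..r}" using assms by auto
    then have rec: "?f n = pCons 0 (?f (n - 1)) + (\<Sum>i = 2..r. smult (var i) (?f (n - i)))"
      using 3 by (simp add: hom_fib_poly_rec[OF as_poly_var1_hom] as_poly_var1_var)
    have n1: "Polynomial.degree (?f (n - 1)) \<le> m" "Polynomial.coeff (?f (n - 1)) m = 1"
      using less.IH[of "n - 1"] 3 assms by (auto simp: m_def)
    have ni: "Polynomial.degree (?f (n - i)) \<le> m" if "i \<in> {2..r}" for i
      using less.IH[of "n - i"] that 3 by (auto simp: m_def)
    have rest: "Polynomial.degree (\<Sum>i = 2..r. smult (var i) (?f (n - i))) \<le> m"
      by (intro degree_sum_le finite_atLeastAtMost) (meson degree_smult_le le_trans ni)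
    have "Polynomial.degree (pCons 0 (?f (n - 1))) \<le> Suc m"
      using n1(1) degree_pCons_le[of 0 "?f (n - 1)"] by linarith
    then have "Polynomial.degree (?f n) \<le> Suc m"
      unfolding rec using rest by (intro degree_add_le) auto
    moreover have "Polynomial.coeff (?f n) (Suc m) = 1"
      unfolding rec using n1(2) rest
      by (simp add: coeff_eq_0[of "\<Sum>i = 2..r. smult (var i) (?f (n - i))" "Suc m"])
    ultimately show ?thesis unfolding m by simp
  qed
qed

lemma as_poly_var1_fib_poly_monic:
  assumes "r \<ge> 1" "n \<ge> r"
  shows "Polynomial.degree (as_poly_var1 (fib_poly r n)) = n + 1 - r"
    and "Polynomial.lead_coeff (as_poly_var1 (fib_poly r n)) = 1"
proof -
  have c: "Polynomial.coeff (as_poly_var1 (fib_poly r n)) (n + 1 - r) = 1"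
    and d: "Polynomial.degree (as_poly_var1 (fib_poly r n)) \<le> n + 1 - r"
    using as_poly_var1_fib_poly[OF assms(1), of n] assms(2) by auto
  from c have "n + 1 - r \<le> Polynomial.degree (as_poly_var1 (fib_poly r n))"
    by (intro le_degree) simp
  with d show e: "Polynomial.degree (as_poly_var1 (fib_poly r n)) = n + 1 - r"
    by simp
  show "Polynomial.lead_coeff (as_poly_var1 (fib_poly r n)) = 1"
    unfolding e by (rule c)
qed

section \<open>Values at points supported on the first three coordinates\<close>

definition pt :: "complex \<Rightarrow> complex \<Rightarrow> complex \<Rightarrow> nat \<Rightarrow> complex" where
  "pt x y z i = (if i = 1 then x else if i = 2 then y else if i = 3 then z else 0)"

abbreviation value_at :: "(nat \<Rightarrow> complex) \<Rightarrow> cpoly \<Rightarrow> complex" where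
  "value_at \<equiv> poly_ev (\<lambda>c. c)"

lemma value_at_hom: "comm_ring_hom (value_at v)"
  by (rule poly_ev_hom[OF hom_ident])

lemma value_at_var: "value_at v (var i) = v i"
  by (rule poly_ev_var[OF hom_ident])

lemma sum_pt:
  assumes "r \<ge> 3"
  shows "(\<Sum>i = 1..r. pt x y z i * g i) = x * g 1 + y * g 2 + z * g 3"
proof -
  have "(\<Sum>i = 1..r. pt x y z i * g i) = (\<Sum>i \<in> {1, 2, 3}. pt x y z i * g i)"
    using assms by (intro sum.mono_neutral_right) (auto simp: pt_def)
  then show ?thesis by (simp add: pt_def)
qed

text \<open>The coordinate 0 is a placeholder: the coefficients of \<open>as_poly_var1 p\<close> are
  free of \<open>var 1\<close>, whose value \<open>x\<close> is supplied afterwards.\<close>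

lemma poly_map_poly_as_poly_var1:
  "poly (map_poly (value_at (pt 0 y z)) (as_poly_var1 p)) x = value_at (pt x y z) p"
proof -
  interpret comm_ring_hom "value_at (pt 0 y z)" by (rule value_at_hom)
  have hom: "comm_ring_hom (\<lambda>q. poly (map_poly (value_at (pt 0 y z)) q) x)"
    by (rule hom_comp[OF hom_poly hom_map_poly[OF value_at_hom]])
  have 1: "(\<lambda>c. poly (map_poly (value_at (pt 0 y z)) [:Poly_Mapping.single 0 c:]) x) = (\<lambda>c. c)"
    by (rule ext) (simp add: map_poly_pCons_hom poly_ev_const[OF hom_ident])
  have 2: "(\<lambda>i. poly (map_poly (value_at (pt 0 y z)) (if i = 1 then [:0, 1:] else [:var i:])) x)
      = pt x y z"
    by (rule ext) (auto simp: map_poly_pCons_hom value_at_var pt_def)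
  show ?thesis
    unfolding as_poly_var1_def hom_poly_ev[OF hom const_cpoly_poly_hom] 1 2 ..
qed

text \<open>Nested to match \<open>bivariate_zero_not_isolated\<close>: third indeterminate outside,
  second inside.\<close>

definition slice23 :: "cpoly \<Rightarrow> complex poly poly" where
  "slice23 = poly_ev (\<lambda>c. [:[:c:]:]) (\<lambda>i. if i = 2 then [:[:0, 1:]:] else if i = 3 then [:0, 1:] else 0)"

lemma poly_slice23: "poly (poly (slice23 p) [:z:]) y = value_at (pt 0 y z) p"
proof -
  have c: "comm_ring_hom (\<lambda>c :: complex. [:[:c:]:])"
    by (rule hom_comp[OF hom_pconst hom_pconst])
  have hom: "comm_ring_hom (\<lambda>q :: complex poly poly. poly (poly q [:z:]) y)"
    by (rule hom_comp[OF hom_poly hom_poly])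
  have 1: "(\<lambda>c. poly (poly [:[:c:]:] [:z:]) y) = (\<lambda>c. c)"
    by (rule ext) simp
  have 2: "(\<lambda>i :: nat. poly (poly (if i = 2 then [:[:0, 1:]:] else if i = 3 then [:0, 1:] else 0) [:z:]) y)
      = pt 0 y z"
    by (rule ext) (auto simp: pt_def)
  show ?thesis
    unfolding slice23_def hom_poly_ev[OF hom c] 1 2 ..
qed

text \<open>On this line only the \<open>var 1\<close> term of the recursion survives.\<close>

lemma value_at_fib_poly_line:
  assumes "r \<ge> 3" "n + 1 \<ge> r"
  shows "value_at (pt x 0 0) (fib_poly r n) = x ^ (n + 1 - r)"
  using assms(2)
proof (induction n rule: less_induct)
  case (less n)
  interpret comm_ring_hom "value_at (pt x 0 0)" by (rule value_at_hom)
  consider "n = r - 1" | "n \<ge> r" using less.prems by linarith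
  then show ?case
  proof cases
    case 1
    then show ?thesis using assms by (simp add: fib_poly_one del: One_nat_def)
  next
    case 2
    have "value_at (pt x 0 0) (fib_poly r n) = x * value_at (pt x 0 0) (fib_poly r (n - 1))"
      unfolding hom_fib_poly_rec[OF value_at_hom 2] value_at_var sum_pt[OF assms(1)] by simp
    also have "value_at (pt x 0 0) (fib_poly r (n - 1)) = x ^ (n - r)"
      using less.IH[of "n - 1"] 2 assms(1) by simp
    finally show ?thesis
      using 2 by (simp add: Suc_diff_le)
  qed
qed

text \<open>The coefficients of degree 0 and 1 are the value at \<open>v\<close> and the \<open>i\<close>-th partial derivative.\<close>

definition along :: "(nat \<Rightarrow> complex) \<Rightarrow> nat \<Rightarrow> cpoly \<Rightarrow> complex poly" where
  "along v i = poly_ev (\<lambda>c. [:c:]) (\<lambda>j. [:v j, if j = i then 1 else 0:])"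

lemma along_hom: "comm_ring_hom (along v i)"
  unfolding along_def by (rule poly_ev_hom[OF hom_pconst])

lemma along_var: "along v i (var j) = [:v j, if j = i then 1 else 0:]"
  unfolding along_def by (rule poly_ev_var[OF hom_pconst])

lemma coeff_along_0: "Polynomial.coeff (along v i p) 0 = value_at v p"
proof -
  have "poly (along v i p) 0 = value_at v p"
    unfolding along_def hom_poly_ev[OF hom_poly hom_pconst] by simp
  then show ?thesis by (simp add: poly_0_coeff_0)
qed

lemma coeff_mult_1:
  "Polynomial.coeff (p * q) 1 = Polynomial.coeff p 0 * Polynomial.coeff q 1
    + Polynomial.coeff p 1 * Polynomial.coeff q 0"
  by (simp add: coeff_mult atMost_Suc add.commute)

text \<open>The product rule applied to the defining recursion gives the recurrences that
  \<open>no_common_zero_of_derivatives\<close> requires.\<close>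

lemma fib_poly_smooth:
  assumes "r \<ge> 3" "n \<ge> r"
    and zero: "\<And>i. i \<in> {1..3} \<Longrightarrow> Polynomial.coeff (along (pt x y z) i (fib_poly r n)) 1 = 0"
  shows "x = 0 \<and> y = 0 \<and> z = 0"
proof (rule no_common_zero_of_derivatives[OF assms(1,2), where
      u = "\<lambda>k. value_at (pt x y z) (fib_poly r k)" and
      d = "\<lambda>i k. Polynomial.coeff (along (pt x y z) i (fib_poly r k)) 1"])
  interpret value_at: comm_ring_hom "value_at (pt x y z)" by (rule value_at_hom)
  show "value_at (pt x y z) (fib_poly r k) = 0" if "k < r - 1" for k
    using that by (simp add: fib_poly_below)
  show "value_at (pt x y z) (fib_poly r (r - 1)) = 1"
    using assms(1) by (simp add: fib_poly_one del: One_nat_def)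
  show "value_at (pt x y z) (fib_poly r k) = x * value_at (pt x y z) (fib_poly r (k - 1))
      + y * value_at (pt x y z) (fib_poly r (k - 2)) + z * value_at (pt x y z) (fib_poly r (k - 3))"
    if "k \<ge> r" for k
    unfolding hom_fib_poly_rec[OF value_at_hom that] value_at_var by (rule sum_pt[OF assms(1)])
next
  fix i k
  interpret along: comm_ring_hom "along (pt x y z) i" by (rule along_hom)
  show "Polynomial.coeff (along (pt x y z) i (fib_poly r k)) 1 = 0" if "k < r"
  proof (cases "k = r - 1")
    case True
    then show ?thesis using assms(1) by (simp add: fib_poly_one del: One_nat_def)
  next
    case False
    then show ?thesis using that by (simp add: fib_poly_below)
  qed
  assume i: "i \<in> {1..3::nat}" and k: "k \<ge> r"
  let ?D = "\<lambda>k. Polynomial.coeff (along (pt x y z) i (fib_poly r k)) 1"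
  let ?u = "\<lambda>k. value_at (pt x y z) (fib_poly r k)"
  \<comment> \<open>In each product the derivative of \<open>var j\<close> is 1 exactly for
    \<open>j = i\<close>, which leaves the extra term \<open>?u (k - i)\<close>.\<close>
  have "?D k = (\<Sum>j = 1..r. pt x y z j * ?D (k - j) + (if j = i then 1 else 0) * ?u (k - j))"
    unfolding hom_fib_poly_rec[OF along_hom k] coeff_sum coeff_mult_1 along_var coeff_along_0 by simp
  also have "\<dots> = (\<Sum>j = 1..r. pt x y z j * ?D (k - j)) + (\<Sum>j = 1..r. if j = i then ?u (k - j) else 0)"
    unfolding sum.distrib by (intro arg_cong2[where f = "(+)"] refl sum.cong) auto
  also have "(\<Sum>j = 1..r. if j = i then ?u (k - j) else 0) = ?u (k - i)"
    using i assms(1) by simp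
  also have "(\<Sum>j = 1..r. pt x y z j * ?D (k - j)) = x * ?D (k - 1) + y * ?D (k - 2) + z * ?D (k - 3)"
    by (rule sum_pt[OF assms(1)])
  finally show "?D k = x * ?D (k - 1) + y * ?D (k - 2) + z * ?D (k - 3) + ?u (k - i)" .
qed (rule zero)

text \<open>A common zero of two factors is a singular point of their product, and the resultant
  yields one outside the origin.\<close>

lemma fib_poly_factor_degree:
  assumes rn: "r \<ge> 3" "n \<ge> r" and AB: "fib_poly r n = A * B"
    and lc: "Polynomial.lead_coeff (as_poly_var1 A) * Polynomial.lead_coeff (as_poly_var1 B) = 1"
    and dA: "Polynomial.degree (as_poly_var1 A) > 0" and dB: "Polynomial.degree (as_poly_var1 B) > 0"
  shows False
proof -
  let ?p = "Polynomial.degree (as_poly_var1 A)" and ?q = "Polynomial.degree (as_poly_var1 B)"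
  let ?a = "\<lambda>C y z. map_poly (value_at (pt 0 y z)) (as_poly_var1 C)"
  \<comment> \<open>The leading coefficients multiply to 1, so no specialisation kills them.\<close>
  have deg: "Polynomial.degree (?a A y z) = ?p" "Polynomial.degree (?a B y z) = ?q" for y z
  proof -
    interpret comm_ring_hom "value_at (pt 0 y z)" by (rule value_at_hom)
    have "value_at (pt 0 y z) (Polynomial.lead_coeff (as_poly_var1 A)) *
        value_at (pt 0 y z) (Polynomial.lead_coeff (as_poly_var1 B)) = 1"
      by (simp only: lc hom_mult[symmetric] hom_one)
    then have "value_at (pt 0 y z) (Polynomial.lead_coeff (as_poly_var1 A)) \<noteq> 0"
      "value_at (pt 0 y z) (Polynomial.lead_coeff (as_poly_var1 B)) \<noteq> 0"
      by auto
    then show "Polynomial.degree (?a A y z) = ?p" "Polynomial.degree (?a B y z) = ?q"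
      by (simp_all add: map_poly_degree_eq)
  qed
  have value_AB: "value_at v (fib_poly r n) = value_at v A * value_at v B" for v
  proof -
    interpret comm_ring_hom "value_at v" by (rule value_at_hom)
    show ?thesis by (simp add: AB hom_mult)
  qed
  \<comment> \<open>Any root over \<open>y = z = 0\<close> is a root of a positive power of
    \<open>x\<close>, hence 0. So both factors vanish at the origin.\<close>
  have root0: "poly (?a C 0 0) 0 = 0" if pos: "Polynomial.degree (?a C 0 0) > 0" and C: "C = A \<or> C = B" for C
  proof -
    obtain x where x: "poly (?a C 0 0) x = 0"
      using pos by (rule complex_poly_root)
    then have "value_at (pt x 0 0) (fib_poly r n) = 0"
      using C by (auto simp: value_AB poly_map_poly_as_poly_var1)
    then have "x = 0"
      using value_at_fib_poly_line[of r n x] rn by simp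
    with x show ?thesis by simp
  qed
  let ?R = "det (sylvester ?p ?q (as_poly_var1 A) (as_poly_var1 B))"
  have R: "poly (poly (slice23 ?R) [:z:]) y = det (sylvester ?p ?q (?a A y z) (?a B y z))" for y z
    unfolding poly_slice23 by (rule det_sylvester_hom[OF value_at_hom, symmetric])
  have "poly (poly (slice23 ?R) [:0:]) 0 = 0"
    unfolding R using dA dB
    by (intro det_sylvester_eq_0_of_common_root[where x = 0] deg root0) (simp_all add: deg)
  then obtain y z where yz: "y \<noteq> 0 \<or> z \<noteq> 0" and "poly (poly (slice23 ?R) [:z:]) y = 0"
    using bivariate_zero_not_isolated by blast
  then have "det (sylvester ?p ?q (?a A y z) (?a B y z)) = 0"
    by (simp only: R)
  moreover have "?a A y z \<noteq> 0" "?a B y z \<noteq> 0"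
    using deg[of y z] dA dB by auto
  ultimately obtain x where "poly (?a A y z) x = 0" "poly (?a B y z) x = 0"
    using common_root_of_det_sylvester_eq_0[OF deg] by blast
  then have "value_at (pt x y z) A = 0" "value_at (pt x y z) B = 0"
    by (simp_all only: poly_map_poly_as_poly_var1)
  \<comment> \<open>Each term of the product rule contains the value of \<open>A\<close> or of
    \<open>B\<close> at the common zero.\<close>
  then have "Polynomial.coeff (along (pt x y z) i A * along (pt x y z) i B) 1 = 0" for i
    by (simp only: coeff_mult_1 coeff_along_0) simp
  moreover have "along (pt x y z) i (fib_poly r n) = along (pt x y z) i A * along (pt x y z) i B" for i
  proof -
    interpret comm_ring_hom "along (pt x y z) i" by (rule along_hom)
    show ?thesis by (simp only: AB hom_mult)
  qed
  ultimately have "Polynomial.coeff (along (pt x y z) i (fib_poly r n)) 1 = 0" for i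
    by simp
  with fib_poly_smooth[OF rn] yz show False by blast
qed

theorem theorem2p7:
  fixes n r :: nat
  assumes "n \<ge> r" and "r \<ge> 3"
  shows "ring_irreducible\<^bsub>cpoly_ring r\<^esub> (fib_poly r n)"
proof -
  interpret domain "cpoly_ring r" by (rule cpoly_ring_domain)
  interpret as_poly_var1: comm_ring_hom as_poly_var1 by (rule as_poly_var1_hom)
  have deg: "Polynomial.degree (as_poly_var1 (fib_poly r n)) > 0"
    and lc: "Polynomial.lead_coeff (as_poly_var1 (fib_poly r n)) = 1"
    using as_poly_var1_fib_poly_monic[of r n] assms by auto
  show ?thesis
  proof (rule ring_irreducibleI)
    show "fib_poly r n \<in> carrier (cpoly_ring r) - {\<zero>\<^bsub>cpoly_ring r\<^esub>}"
      using fib_poly_in_carrier deg by (auto simp: cpoly_ring_simps)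
    show "fib_poly r n \<notin> Units (cpoly_ring r)"
    proof
      assume "fib_poly r n \<in> Units (cpoly_ring r)"
      then obtain G where "fib_poly r n * G = 1"
        by (auto simp: Units_def cpoly_ring_simps)
      then have "as_poly_var1 (fib_poly r n) * as_poly_var1 G = 1"
        by (metis as_poly_var1.hom_mult as_poly_var1.hom_one)
      then have "as_poly_var1 (fib_poly r n) dvd 1"
        by (metis dvd_triv_left)
      with deg show False
        by (simp add: poly_dvd_1)
    qed
  next
    fix A B assume carr: "A \<in> carrier (cpoly_ring r)" "B \<in> carrier (cpoly_ring r)"
      and "fib_poly r n = A \<otimes>\<^bsub>cpoly_ring r\<^esub> B"
    then have AB: "fib_poly r n = A * B" by (simp add: cpoly_ring_simps)
    then have "as_poly_var1 (fib_poly r n) = as_poly_var1 A * as_poly_var1 B"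
      by (simp add: as_poly_var1.hom_mult)
    with lc have lcAB: "Polynomial.lead_coeff (as_poly_var1 A) * Polynomial.lead_coeff (as_poly_var1 B) = 1"
      by (simp add: lead_coeff_mult)
    \<comment> \<open>Here \<open>C\<close> is its own leading coefficient, so \<open>u\<close>
      inverts it among all polynomials, which \<open>cpoly_ring_Units_I\<close> accepts.\<close>
    have unit: "C \<in> Units (cpoly_ring r)"
      if "C \<in> carrier (cpoly_ring r)" "Polynomial.degree (as_poly_var1 C) = 0"
        "Polynomial.lead_coeff (as_poly_var1 C) * u = 1" for C u
    proof -
      from that(2) obtain c where c: "as_poly_var1 C = [:c:]"
        by (rule degree_eq_zeroE)
      then have "C = c"
        using poly_as_poly_var1[of C] by simp
      with c that(3) show ?thesis
        by (intro cpoly_ring_Units_I[OF that(1), of u]) simp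
    qed
    show "A \<in> Units (cpoly_ring r) \<or> B \<in> Units (cpoly_ring r)"
    proof (cases "Polynomial.degree (as_poly_var1 A) = 0 \<or> Polynomial.degree (as_poly_var1 B) = 0")
      case True
      then show ?thesis
        using unit[OF carr(1) _ lcAB] unit[OF carr(2), of "Polynomial.lead_coeff (as_poly_var1 A)"] lcAB
        by (auto simp: mult.commute)
    next
      case False
      then show ?thesis
        using fib_poly_factor_degree[OF assms(2,1) AB lcAB] by auto
    qed
  qed
qed

end
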